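(* Let $n_1,\dots,n_k\ge 1$ be integers, $N=n_1+\cdots+n_k$, and let $\lambda_i, a_{in}\in\mathbb{C}$ ($1\le i\le k$, $0\le n\le n_i-1$). Put $f_{[A_i]}(x)=\sum_{n=0}^{n_i-1}a_{in}x^n$, $A_i=f_{[A_i]}(J_{n_i}(0))$, $J=\bigoplus_{i=1}^k J_{n_i}(\lambda_i)$, $A=\bigoplus_{i=1}^k A_i$, and let $E$ be the $N\times N$ identity matrix. Let $z_1\in\mathbb{C}$ satisfy $1+z_1\lambda_i\neq 0$ for all $i$. For each $i$ define the power series at $x=0$ $$f_{i}(x)=\frac{\lambda_i+x}{1+z_1\lambda_i+z_1x},\qquad g_{i}(x)=\frac{f_{[A_i]}(x)}{1+z_1\lambda_i+z_1x},$$ and let $f_i^{-1}$ denote the compositional inverse of $f_i$ (modulo $x^{n_i}$). Then there exist invertible $N\times N$ complex matrices $P,Q$ such that $$P(E+z_1J)Q=E,\qquad PJQ=\bigoplus_{i=1}^k J_{n_i}\!\left(\frac{\lambda_i}{1+z_1\lambda_i}\right),\qquad PAQ=\bigoplus_{i=1}^k A_i',$$ where $$A_i'=\bigl(g_i\circ f_i^{-1}\bigr)\!\left(J_{n_i}\!\left(\frac{\lambda_i}{1+z_1\lambda_i}\right)\right).$$ In particular the triples $(E,J,A)$ and $\bigl(E,\bigoplus_i J_{n_i}(\tfrac{\lambda_i}{1+z_1\lambda_i}),\bigoplus_i A_i'\bigr)$ are SLOCC equivalent.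
   Context: $J_n(\lambda)$ is the $n\times n$ upper triangular Jordan block with eigenvalue $\lambda$ (ones on the superdiagonal), so $J_n(\lambda)=\lambda+J_n(0)$ and $J_n(0)^n=0$. A power series in $x$ is evaluated at $J_n(0)$ by truncating modulo $x^n$. Compositional inverse: if $f(x)=\mu+c_1x+c_2x^2+\cdots$ is a power series with $c_1\neq0$ (this condition is vacuous when $n=1$), then $f^{-1}(t)$ is a polynomial in $(t-\mu)$ without constant term, determined modulo $(t-\mu)^n$ by $f^{-1}(f(x))\equiv x \pmod{x^n}$ (when $n=1$ it is $0$). The matrix $(g\circ f^{-1})(J_n(\mu))$ is $g(f^{-1}(J_n(\mu)))$, obtained by substituting $t-\mu=J_n(0)$; it is well defined because $J_n(0)^n=0$. A pure state of a $3\times N\times N$ system is represented by a triple $(\Gamma_1,\Gamma_2,\Gamma_3)$ of complex $N\times N$ matrices. Two triples $(\Gamma_1,\Gamma_2,\Gamma_3)$ and $(\Gamma_1',\Gamma_2',\Gamma_3')$ are SLOCC equivalent if there are an invertible complex $3\times3$ matrix $T=(T_{ij})$ and invertible complex $N\times N$ matrices $P,Q$ with $\sum_{j=1}^3T_{ij}P\Gamma_jQ=\Gamma_i'$ for $i=1,2,3$. *)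

theory Defs
  imports
    "Jordan_Normal_Form.Jordan_Normal_Form"
    "HOL-Computational_Algebra.Formal_Power_Series"
begin

text \<open>Evaluation of a power series at an \<open>n \<times> n\<close> matrix, truncating modulo \<open>x ^ n\<close>. It is
  meaningful for nilpotent matrices, where the omitted powers vanish.\<close>

definition fps_eval_mat :: "complex fps \<Rightarrow> complex mat \<Rightarrow> complex mat" where
  "fps_eval_mat h M = mat (dim_row M) (dim_row M)
     (\<lambda>(r, s). \<Sum>m<dim_row M. fps_nth h m * (M ^\<^sub>m m) $$ (r, s))"

text \<open>The compositional inverse modulo \<open>x ^ n\<close> of \<open>f = \<mu> + c\<^sub>1 x + \<dots>\<close>, as a series in the variable
  \<open>t - \<mu>\<close>. The library's \<^const>\<open>fps_inv\<close> inverts series without constant term, so \<open>\<mu>\<close> is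
  subtracted first. The defining congruence and uniqueness are the two lemmas below.\<close>

definition fps_comp_inv :: "nat \<Rightarrow> complex fps \<Rightarrow> complex fps" where
  "fps_comp_inv n f = fps_cutoff n (fps_inv (f - fps_const (fps_nth f 0)))"

lemma fps_compose_nth_cong:
  fixes h h' b :: "complex fps"
  assumes "\<And>j. j \<le> m \<Longrightarrow> fps_nth h j = fps_nth h' j"
  shows "fps_nth (fps_compose h b) m = fps_nth (fps_compose h' b) m"
  using assms by (simp add: fps_compose_nth)

lemma fps_comp_inv_compose:
  assumes "fps_nth f 1 \<noteq> 0 \<or> n = 1" and "m < n"
  shows "fps_nth (fps_compose (fps_comp_inv n f) (f - fps_const (fps_nth f 0))) m = fps_nth fps_X m"
proof -
  let ?b = "f - fps_const (fps_nth f 0)"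
  have "fps_nth (fps_compose (fps_comp_inv n f) ?b) m = fps_nth (fps_compose (fps_inv ?b) ?b) m"
    using assms(2) by (intro fps_compose_nth_cong) (simp add: fps_comp_inv_def)
  also have "\<dots> = fps_nth fps_X m"
  proof (cases "fps_nth f 1 = 0")
    case True
    with assms have "m = 0" by auto
    then show ?thesis by (simp add: fps_inv_def)
  next
    case False
    then show ?thesis by (subst fps_inv) simp_all
  qed
  finally show ?thesis .
qed

lemma fps_comp_inv_unique:
  assumes c1: "fps_nth f 1 \<noteq> 0 \<or> n = 1"
    and h0: "fps_nth h 0 = 0"
    and h: "\<And>m. m < n \<Longrightarrow> fps_nth (fps_compose h (f - fps_const (fps_nth f 0))) m = fps_nth fps_X m"
    and m: "m < n"
  shows "fps_nth h m = fps_nth (fps_comp_inv n f) m"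
proof (cases "fps_nth f 1 = 0")
  case True
  with c1 m have "n = 1" "m = 0" by auto
  then show ?thesis using h0 by (simp add: fps_comp_inv_def fps_inv_def)
next
  case False
  let ?b = "f - fps_const (fps_nth f 0)"
  have b: "fps_nth ?b 0 = 0" "fps_nth ?b 1 \<noteq> 0" using False by simp_all
  have i0: "fps_nth (fps_inv ?b) 0 = 0" by (simp add: fps_inv_def)
  have r: "fps_compose ?b (fps_inv ?b) = fps_X"
    using fps_inv_right[OF b] .
  let ?d = "fps_compose h ?b"
  have "h = fps_compose h (fps_compose ?b (fps_inv ?b))" by (simp add: r)
  also have "\<dots> = fps_compose ?d (fps_inv ?b)"
    by (rule fps_compose_assoc[OF i0 b(1)])
  finally have "fps_nth h m = fps_nth (fps_compose ?d (fps_inv ?b)) m" by simp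
  also have "\<dots> = fps_nth (fps_compose fps_X (fps_inv ?b)) m"
    using h m by (intro fps_compose_nth_cong) simp
  also have "\<dots> = fps_nth (fps_inv ?b) m" using i0 by simp
  finally show ?thesis using m by (simp add: fps_comp_inv_def)
qed

text \<open>\<open>(g \<circ> f\<inverse>)(M)\<close> for an \<open>n \<times> n\<close> matrix \<open>M\<close> such as \<open>J\<^sub>n(\<mu>)\<close>, where \<open>\<mu> = f(0)\<close>: the variable
  \<open>t - \<mu>\<close> of \<open>f\<inverse>\<close> is replaced by \<open>M - \<mu> E\<close>, and \<open>g\<close> is evaluated at the resulting matrix.\<close>

definition comp_inv_eval_mat :: "complex fps \<Rightarrow> complex fps \<Rightarrow> complex mat \<Rightarrow> complex mat" where
  "comp_inv_eval_mat g f M =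
     fps_eval_mat g
       (fps_eval_mat (fps_comp_inv (dim_row M) f) (M - fps_nth f 0 \<cdot>\<^sub>m 1\<^sub>m (dim_row M)))"

fun slocc_equivalent ::
  "nat \<Rightarrow> complex mat \<times> complex mat \<times> complex mat \<Rightarrow> complex mat \<times> complex mat \<times> complex mat \<Rightarrow> bool"
where
  "slocc_equivalent N (G1, G2, G3) (H1, H2, H3) \<longleftrightarrow>
     {G1, G2, G3, H1, H2, H3} \<subseteq> carrier_mat N N \<and>
     (\<exists>T P Q. T \<in> carrier_mat 3 3 \<and> invertible_mat T \<and>
        P \<in> carrier_mat N N \<and> invertible_mat P \<and>
        Q \<in> carrier_mat N N \<and> invertible_mat Q \<and>
        (\<forall>(i, H) \<in> {(0, H1), (1, H2), (2, H3)}.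
           T $$ (i, 0) \<cdot>\<^sub>m (P * G1 * Q) + T $$ (i, 1) \<cdot>\<^sub>m (P * G2 * Q) + T $$ (i, 2) \<cdot>\<^sub>m (P * G3 * Q) = H))"

end

theory Submission
  imports Defs
begin

text \<open>Let the row vectors of length \<open>n\<close> stand for power series modulo \<open>x ^ n\<close>. A series \<open>h\<close> evaluated at
  \<open>J\<^sub>n(0)\<close> is then right multiplication by \<open>h\<close>, and substitution of a series \<open>u\<close> with \<open>u(0) = 0\<close> is also
  a matrix; since substitution is an algebra homomorphism, conjugating by it turns multiplication by \<open>h\<close>
  into multiplication by \<open>h \<circ> u\<close>. On one block put \<open>d = 1 + z\<^sub>1 \<lambda> + z\<^sub>1 x\<close>, so that \<open>E + z\<^sub>1 J\<close>, \<open>J\<close>, \<open>A\<close> are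
  multiplication by \<open>d\<close>, \<open>\<lambda> + x = f d\<close>, \<open>f\<^sub>A = g d\<close>. Dividing by \<open>d\<close> and conjugating by the substitution
  of \<open>u = f\<inverse>\<close> gives \<open>1\<close>, \<open>f \<circ> f\<inverse> = \<mu> + x\<close> and \<open>g \<circ> f\<inverse>\<close>.\<close>

section \<open>Matrices whose rows are truncated power series\<close>

definition fps_rows_mat :: "nat \<Rightarrow> (nat \<Rightarrow> 'a fps) \<Rightarrow> 'a mat" where
  "fps_rows_mat n F = mat n n (\<lambda>(r, s). fps_nth (F r) s)"

text \<open>Row \<open>r\<close> is the image of the basis vector x^r under multiplication by
  \<open>h\<close>. Vectors are rows, so in a product the left factor acts first.\<close>

definition toeplitz_mat :: "nat \<Rightarrow> 'a::comm_semiring_1 fps \<Rightarrow> 'a mat" where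
  "toeplitz_mat n h = fps_rows_mat n (\<lambda>r. fps_X ^ r * h)"

definition composition_mat :: "nat \<Rightarrow> 'a::comm_semiring_1 fps \<Rightarrow> 'a mat" where
  "composition_mat n u = fps_rows_mat n (\<lambda>r. u ^ r)"

lemma fps_rows_mat_carrier [simp]: "fps_rows_mat n F \<in> carrier_mat n n"
  by (simp add: fps_rows_mat_def)

lemma toeplitz_mat_carrier [simp]: "toeplitz_mat n h \<in> carrier_mat n n"
  by (simp add: toeplitz_mat_def)

lemma toeplitz_mat_dim [simp]:
  "dim_row (toeplitz_mat n h) = n" "dim_col (toeplitz_mat n h) = n"
  by (simp_all add: toeplitz_mat_def fps_rows_mat_def)

lemma composition_mat_carrier [simp]: "composition_mat n u \<in> carrier_mat n n"
  by (simp add: composition_mat_def)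

lemma toeplitz_mat_index:
  "r < n \<Longrightarrow> s < n \<Longrightarrow> toeplitz_mat n h $$ (r, s) = (if s < r then 0 else fps_nth h (s - r))"
  by (simp add: toeplitz_mat_def fps_rows_mat_def fps_X_power_mult_nth)

text \<open>Since u(0) = 0, the power \<open>u ^ j\<close> starts at degree \<open>j\<close> or
  later, so any cutoff above \<open>m\<close> captures every contributing term.\<close>

lemma fps_nth_compose_below:
  fixes h u :: "'a::idom fps"
  assumes "fps_nth u 0 = 0" "m < n"
  shows "(\<Sum>j<n. fps_nth h j * fps_nth (u ^ j) m) = fps_nth (h oo u) m"
proof -
  have "(\<Sum>j<n. fps_nth h j * fps_nth (u ^ j) m) = (\<Sum>j\<in>{0..m}. fps_nth h j * fps_nth (u ^ j) m)"
    using assms by (intro sum.mono_neutral_right) (auto simp: startsby_zero_power_prefix)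
  then show ?thesis by (simp add: fps_compose_nth)
qed

lemma fps_rows_mat_mult:
  "fps_rows_mat n F * fps_rows_mat n G =
     mat n n (\<lambda>(r, s). \<Sum>j<n. fps_nth (F r) j * fps_nth (G j) s)"
  by (rule eq_matI) (auto simp: fps_rows_mat_def scalar_prod_def lessThan_atLeast0)

text \<open>The product substitutes \<open>u\<close> into each row; truncating the rows loses
  nothing because u(0) = 0 makes discarded terms contribute only in degrees at least
  \<open>n\<close>.\<close>

lemma fps_rows_mat_mult_composition:
  fixes u :: "'a::idom fps"
  assumes "fps_nth u 0 = 0"
  shows "fps_rows_mat n F * composition_mat n u = fps_rows_mat n (\<lambda>r. F r oo u)"
  unfolding composition_mat_def fps_rows_mat_mult
  by (rule eq_matI) (auto simp: fps_rows_mat_def fps_nth_compose_below[OF assms])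

text \<open>Multiplication by \<open>h\<close> never lowers degrees, so the coefficient at
  \<open>s\<close> involves only \<open>j \<le> s\<close> and the matrix sum is the Cauchy
  product.\<close>

lemma fps_rows_mat_mult_toeplitz:
  "fps_rows_mat n F * toeplitz_mat n h = fps_rows_mat n (\<lambda>r. F r * h)"
  unfolding toeplitz_mat_def fps_rows_mat_mult
proof (rule eq_matI)
  fix r s assume "r < dim_row (fps_rows_mat n (\<lambda>r. F r * h))" "s < dim_col (fps_rows_mat n (\<lambda>r. F r * h))"
  then have rs: "r < n" "s < n" by (simp_all add: fps_rows_mat_def)
  have "(\<Sum>j<n. fps_nth (F r) j * fps_nth (fps_X ^ j * h) s) =
      (\<Sum>j\<in>{0..s}. fps_nth (F r) j * fps_nth h (s - j))"
    using rs by (intro sum.mono_neutral_cong_right) (auto simp: fps_X_power_mult_nth)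
  then show "mat n n (\<lambda>(r, s). \<Sum>j<n. fps_nth (F r) j * fps_nth (fps_X ^ j * h) s) $$ (r, s) =
      fps_rows_mat n (\<lambda>r. F r * h) $$ (r, s)"
    using rs by (simp add: fps_rows_mat_def fps_mult_nth)
qed (simp_all add: fps_rows_mat_def)

lemma toeplitz_mat_mult: "toeplitz_mat n g * toeplitz_mat n h = toeplitz_mat n (g * h)"
  by (simp add: toeplitz_mat_def[of n g] toeplitz_mat_def[of n "g * h"]
      fps_rows_mat_mult_toeplitz mult.assoc)

lemma toeplitz_mat_one: "toeplitz_mat n 1 = 1\<^sub>m n"
  by (rule eq_matI) (auto simp: toeplitz_mat_def fps_rows_mat_def fps_X_power_nth)

lemma toeplitz_mat_power: "toeplitz_mat n h ^\<^sub>m m = toeplitz_mat n (h ^ m)"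
proof (induction m)
  case 0
  show ?case by (simp add: toeplitz_mat_one)
next
  case (Suc m)
  then show ?case by (simp add: toeplitz_mat_mult mult.commute)
qed

section \<open>Jordan blocks and evaluation of series at them\<close>

lemma jordan_block_eq_toeplitz:
  "jordan_block n l = toeplitz_mat n (fps_const (l::'a::comm_ring_1) + fps_X)"
  by (rule eq_matI) (auto simp: toeplitz_mat_index)

text \<open>The m-th power of the matrix belongs to \<open>u ^ m\<close>, so its entry (r, s) sums
  the degree s - r coefficients of the terms of \<open>h oo u\<close>, and s - r < n.\<close>

lemma fps_eval_mat_toeplitz:
  assumes "fps_nth u 0 = 0"
  shows "fps_eval_mat h (toeplitz_mat n u) = toeplitz_mat n (h oo u)"
proof (rule eq_matI)
  fix r s assume "r < dim_row (toeplitz_mat n (h oo u))" "s < dim_col (toeplitz_mat n (h oo u))"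
  then have rs: "r < n" "s < n"
    by simp_all
  then show "fps_eval_mat h (toeplitz_mat n u) $$ (r, s) = toeplitz_mat n (h oo u) $$ (r, s)"
    using fps_nth_compose_below[OF assms, of "s - r" n h]
    by (simp add: fps_eval_mat_def toeplitz_mat_power toeplitz_mat_index)
qed (simp_all add: fps_eval_mat_def)

lemma toeplitz_mat_cong:
  "(\<And>m. m < n \<Longrightarrow> fps_nth g m = fps_nth h m) \<Longrightarrow> toeplitz_mat n g = toeplitz_mat n h"
  by (rule eq_matI) (auto simp: toeplitz_mat_index)

lemma comp_inv_eval_mat_jordan_block:
  "comp_inv_eval_mat g f (jordan_block n (fps_nth f 0)) =
     toeplitz_mat n (g oo fps_inv (f - fps_const (fps_nth f 0)))"
proof -
  let ?u = "fps_inv (f - fps_const (fps_nth f 0))"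
  have u0: "fps_nth ?u 0 = 0" by (simp add: fps_inv_def)
  have nil: "jordan_block n (fps_nth f 0) - fps_nth f 0 \<cdot>\<^sub>m 1\<^sub>m n = toeplitz_mat n fps_X"
    by (rule eq_matI) (auto simp: toeplitz_mat_index)
  \<comment> \<open>The cutoff in \<open>fps_comp_inv\<close> disappears because an n by n Toeplitz
    matrix sees only coefficients below \<open>n\<close>.\<close>
  have "fps_eval_mat (fps_comp_inv n f) (toeplitz_mat n fps_X) = toeplitz_mat n ?u"
    by (subst fps_eval_mat_toeplitz) (auto intro!: toeplitz_mat_cong simp: fps_comp_inv_def)
  then show ?thesis
    by (simp add: comp_inv_eval_mat_def nil fps_eval_mat_toeplitz[OF u0])
qed

section \<open>Transformation of a single block\<close>

text \<open>Row \<open>r\<close> becomes \<open>b ^ r * inverse d * h\<close> with \<open>u\<close>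
  substituted. Substitution is multiplicative and sends \<open>b ^ r\<close> to x^r.\<close>

lemma toeplitz_mat_conjugate:
  fixes b d h u :: "'a::field fps"
  assumes u0: "fps_nth u 0 = 0" and bu: "b oo u = fps_X"
  shows "composition_mat n b * toeplitz_mat n (inverse d) * toeplitz_mat n h * composition_mat n u =
    toeplitz_mat n ((h * inverse d) oo u)"
proof -
  have "fps_rows_mat n (\<lambda>r. b ^ r * inverse d * h oo u) =
      fps_rows_mat n (\<lambda>r. fps_X ^ r * (h * inverse d oo u))"
    by (simp add: fps_compose_mult_distrib[OF u0] fps_compose_power[OF u0, symmetric] bu mult_ac)
  then show ?thesis
    by (simp add: composition_mat_def[of n b] fps_rows_mat_mult_toeplitz
        fps_rows_mat_mult_composition[OF u0] toeplitz_mat_def[of n "h * inverse d oo u"])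
qed

lemma composition_mat_inverse:
  fixes b u :: "'a::field fps"
  assumes "fps_nth u 0 = 0" "b oo u = fps_X"
  shows "composition_mat n b * composition_mat n u = 1\<^sub>m n"
  unfolding composition_mat_def[of n b]
  by (simp add: fps_rows_mat_mult_composition fps_compose_power[symmetric] assms
      toeplitz_mat_one[symmetric] toeplitz_mat_def)

text \<open>Explicit right inverses \<open>P'\<close> and \<open>Q'\<close> are provided because
  their direct sums will witness invertibility of the assembled matrices.\<close>

lemma jordan_block_pencil_transform:
  fixes n :: nat and l z :: complex and fA f g :: "complex fps"
  assumes d0: "1 + z * l \<noteq> 0"
    and f: "f = (fps_const l + fps_X) / (fps_const (1 + z * l) + fps_const z * fps_X)"
    and g: "g = fA / (fps_const (1 + z * l) + fps_const z * fps_X)"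
  shows "\<exists>P Q P' Q'. {P, Q, P', Q'} \<subseteq> carrier_mat n n \<and> P * P' = 1\<^sub>m n \<and> Q * Q' = 1\<^sub>m n \<and>
     P * (1\<^sub>m n + z \<cdot>\<^sub>m jordan_block n l) * Q = 1\<^sub>m n \<and>
     P * jordan_block n l * Q = jordan_block n (l / (1 + z * l)) \<and>
     P * fps_eval_mat fA (jordan_block n 0) * Q =
       comp_inv_eval_mat g f (jordan_block n (l / (1 + z * l)))"
proof -
  define d where "d = fps_const (1 + z * l) + fps_const z * fps_X"
  define \<mu> where "\<mu> = l / (1 + z * l)"
  define b where "b = f - fps_const \<mu>"
  define u where "u = fps_inv b"
  have d_nth0: "fps_nth d 0 \<noteq> 0" using d0 by (simp add: d_def)
  have d_inv: "d * inverse d = 1" by (rule inverse_mult_eq_1'[OF d_nth0])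
  have f_eq: "f = (fps_const l + fps_X) * inverse d" and g_eq: "g = fA * inverse d"
    using d_nth0 by (simp_all add: f g d_def[symmetric] fps_divide_unit)
  have f0: "fps_nth f 0 = \<mu>" using d0 by (simp add: f_eq d_def \<mu>_def divide_inverse)
  have fd: "f * d = fps_const l + fps_X"
    using d_inv by (simp add: f_eq mult.assoc mult.commute[of "inverse d"])
  \<comment> \<open>The linear coefficient of \<open>f\<close> must be nonzero for \<open>b\<close>
    to have a compositional inverse. If it vanished, comparing coefficients of x in
    \<open>f * d\<close> would give \<mu> z = 1, that is z l = 1 + z l.\<close>
  have "fps_nth (f * d) 1 = 1" by (simp add: fd)
  then have "fps_nth f 1 * (1 + z * l) + \<mu> * z = 1"
    by (simp add: fps_mult_nth d_def f0 add.commute)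
  moreover have "\<mu> * z \<noteq> 1" using d0 by (auto simp: \<mu>_def field_simps)
  ultimately have "fps_nth f 1 \<noteq> 0" by auto
  then have b: "fps_nth b 0 = 0" "fps_nth b 1 \<noteq> 0" by (simp_all add: b_def f0)
  have u0: "fps_nth u 0 = 0" by (simp add: u_def fps_inv_def)
  have bu: "b oo u = fps_X" unfolding u_def by (rule fps_inv_right[OF b])
  have ub: "u oo b = fps_X" unfolding u_def by (rule fps_inv[OF b])
  have fu: "f oo u = fps_const \<mu> + fps_X"
    using bu by (simp add: b_def fps_compose_sub_distrib algebra_simps)
  \<comment> \<open>Substitution of \<open>b\<close> undoes that of \<open>u\<close>; the extra
    factor \<open>inverse d\<close> in \<open>P\<close> normalizes the pencil \<open>d\<close> to
    1.\<close>
  define P where "P = composition_mat n b * toeplitz_mat n (inverse d)"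
  define Q where "Q = composition_mat n u"
  define P' where "P' = toeplitz_mat n d * composition_mat n u"
  define Q' where "Q' = composition_mat n b"
  have conj: "P * toeplitz_mat n h * Q = toeplitz_mat n ((h * inverse d) oo u)" for h
    unfolding P_def Q_def by (rule toeplitz_mat_conjugate[OF u0 bu])
  \<comment> \<open>\<open>P'\<close> ends in \<open>Q\<close>, so this is the case h = d of
    \<open>conj\<close>.\<close>
  have "P * P' = P * toeplitz_mat n d * Q"
    unfolding P_def P'_def Q_def by (rule assoc_mult_mat[symmetric, of _ n n _ n _ n]) (auto intro: mult_carrier_mat[of _ n n _ n])
  also have "\<dots> = 1\<^sub>m n" by (simp add: conj d_inv toeplitz_mat_one)
  finally have PP': "P * P' = 1\<^sub>m n" .
  have QQ': "Q * Q' = 1\<^sub>m n"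
    unfolding Q_def Q'_def by (rule composition_mat_inverse[OF b(1) ub])
  have E: "1\<^sub>m n + z \<cdot>\<^sub>m jordan_block n l = toeplitz_mat n d"
    by (rule eq_matI) (auto simp: toeplitz_mat_index d_def)
  have A: "fps_eval_mat fA (jordan_block n 0) = toeplitz_mat n fA"
    by (simp add: jordan_block_eq_toeplitz fps_eval_mat_toeplitz)
  have A': "comp_inv_eval_mat g f (jordan_block n \<mu>) = toeplitz_mat n (g oo u)"
    using comp_inv_eval_mat_jordan_block[of g f n] by (simp add: f0 b_def u_def)
  have "P * (1\<^sub>m n + z \<cdot>\<^sub>m jordan_block n l) * Q = 1\<^sub>m n"
    by (simp add: E conj d_inv toeplitz_mat_one)
  moreover have "P * jordan_block n l * Q = jordan_block n \<mu>"
    by (simp add: jordan_block_eq_toeplitz conj f_eq[symmetric] fu)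
  moreover have "P * fps_eval_mat fA (jordan_block n 0) * Q = comp_inv_eval_mat g f (jordan_block n \<mu>)"
    by (simp only: A A' conj g_eq[symmetric])
  moreover have "{P, Q, P', Q'} \<subseteq> carrier_mat n n"
    by (auto simp: P_def Q_def P'_def Q'_def intro: mult_carrier_mat[of _ n n _ n])
  ultimately show ?thesis using PP' QQ' unfolding \<mu>_def by blast
qed

section \<open>Blockwise arithmetic of block-diagonal matrices\<close>

lemma diag_block_mat_map_carrier:
  "(\<And>i. i \<in> set is \<Longrightarrow> F i \<in> carrier_mat (n i) (n i)) \<Longrightarrow>
    diag_block_mat (map F is) \<in> carrier_mat (sum_list (map n is)) (sum_list (map n is))"
  by (induction "is") (auto simp: Let_def)

text \<open>Mapping both families over one index list lets the induction split off matching blocks;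
  products with the zero off-diagonal blocks vanish.\<close>

lemma diag_block_mat_map_mult:
  assumes "\<And>i. i \<in> set is \<Longrightarrow> F i \<in> carrier_mat (n i) (n i)"
    and "\<And>i. i \<in> set is \<Longrightarrow> G i \<in> carrier_mat (n i) (n i)"
  shows "diag_block_mat (map F is) * diag_block_mat (map G is) =
    diag_block_mat (map (\<lambda>i. F i * G i :: 'a::semiring_0 mat) is)"
  using assms
proof (induction "is")
  case (Cons i "is")
  let ?m = "sum_list (map n is)"
  have C: "F i \<in> carrier_mat (n i) (n i)" "G i \<in> carrier_mat (n i) (n i)"
    "diag_block_mat (map F is) \<in> carrier_mat ?m ?m" "diag_block_mat (map G is) \<in> carrier_mat ?m ?m"
    "diag_block_mat (map (\<lambda>i. F i * G i) is) \<in> carrier_mat ?m ?m"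
    using Cons.prems by (auto intro!: diag_block_mat_map_carrier mult_carrier_mat)
  show ?case
    using C Cons.IH Cons.prems
    by (simp add: Let_def mult_four_block_mat[of _ "n i" "n i" _ ?m _ ?m _ _ "n i" _ ?m]
        carrier_matD[OF C(1)] carrier_matD[OF C(2)] right_add_zero_mat[OF mult_carrier_mat[OF C(1,2)]])
qed simp

lemma diag_block_mat_map_add:
  assumes "\<And>i. i \<in> set is \<Longrightarrow> F i \<in> carrier_mat (n i) (n i)"
    and "\<And>i. i \<in> set is \<Longrightarrow> G i \<in> carrier_mat (n i) (n i)"
  shows "diag_block_mat (map F is) + diag_block_mat (map G is) =
    diag_block_mat (map (\<lambda>i. F i + G i :: 'a::monoid_add mat) is)"
  using assms
proof (induction "is")
  case (Cons i "is")
  let ?m = "sum_list (map n is)"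
  have C: "F i \<in> carrier_mat (n i) (n i)" "G i \<in> carrier_mat (n i) (n i)"
    "diag_block_mat (map F is) \<in> carrier_mat ?m ?m" "diag_block_mat (map G is) \<in> carrier_mat ?m ?m"
    "diag_block_mat (map (\<lambda>i. F i + G i) is) \<in> carrier_mat ?m ?m"
    using Cons.prems by (auto intro!: diag_block_mat_map_carrier)
  show ?case
    using C Cons.IH Cons.prems
    by (simp add: Let_def add_four_block_mat[of _ "n i" "n i" _ ?m _ ?m] carrier_matD[OF C(1)]
        carrier_matD[OF C(2)])
qed simp

lemma diag_block_mat_map_smult:
  "c \<cdot>\<^sub>m diag_block_mat (map F is) = diag_block_mat (map (\<lambda>i. c \<cdot>\<^sub>m F i :: 'a::mult_zero mat) is)"
proof (induction "is")
  case (Cons i "is")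
  show ?case
    by (rule eq_matI) (auto simp: Let_def Cons[symmetric])
qed auto

lemma diag_block_mat_map_one:
  "diag_block_mat (map (\<lambda>i. 1\<^sub>m (n i)) is) = 1\<^sub>m (sum_list (map n is))"
  by (induction "is") (auto simp: Let_def)

lemma invertible_mat_if_right_inverse:
  fixes A :: "'a::field mat"
  assumes "A \<in> carrier_mat n n" "B \<in> carrier_mat n n" "A * B = 1\<^sub>m n"
  shows "invertible_mat A"
  using assms mat_mult_left_right_inverse[OF assms]
  by (auto simp: invertible_mat_def inverts_mat_def)

section \<open>Assembly of the blocks and SLOCC equivalence\<close>

theorem mainTheorem1:
  fixes k N :: nat and n :: "nat \<Rightarrow> nat"
    and l :: "nat \<Rightarrow> complex" and a :: "nat \<Rightarrow> nat \<Rightarrow> complex" and z1 :: complex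
    and fA f g :: "nat \<Rightarrow> complex fps"
    and E J A J' A' :: "complex mat"
  assumes n_pos: "\<And>i. i \<in> {1..k} \<Longrightarrow> n i \<ge> 1"
    and N_def: "N = (\<Sum>i=1..k. n i)"
    and fA_def: "fA = (\<lambda>i. \<Sum>m<n i. fps_const (a i m) * fps_X ^ m)"
    and E_def: "E = 1\<^sub>m N"
    and J_def: "J = diag_block_mat (map (\<lambda>i. jordan_block (n i) (l i)) [1..<k+1])"
    and A_def: "A = diag_block_mat (map (\<lambda>i. fps_eval_mat (fA i) (jordan_block (n i) 0)) [1..<k+1])"
    and z1: "\<And>i. i \<in> {1..k} \<Longrightarrow> 1 + z1 * l i \<noteq> 0"
    and f_def: "f = (\<lambda>i. (fps_const (l i) + fps_X) / (fps_const (1 + z1 * l i) + fps_const z1 * fps_X))"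
    and g_def: "g = (\<lambda>i. fA i / (fps_const (1 + z1 * l i) + fps_const z1 * fps_X))"
    and J'_def: "J' = diag_block_mat (map (\<lambda>i. jordan_block (n i) (l i / (1 + z1 * l i))) [1..<k+1])"
    and A'_def: "A' = diag_block_mat (map (\<lambda>i.
          comp_inv_eval_mat (g i) (f i) (jordan_block (n i) (l i / (1 + z1 * l i)))) [1..<k+1])"
  shows "(\<exists>P Q. P \<in> carrier_mat N N \<and> invertible_mat P \<and> Q \<in> carrier_mat N N \<and> invertible_mat Q \<and>
            P * (E + z1 \<cdot>\<^sub>m J) * Q = E \<and> P * J * Q = J' \<and> P * A * Q = A')
         \<and> slocc_equivalent N (E, J, A) (E, J', A')"
proof -
  let ?is = "[1..<k+1]"
  define \<mu> where "\<mu> = (\<lambda>i. l i / (1 + z1 * l i))"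
  define Js where "Js = (\<lambda>i. jordan_block (n i) (l i))"
  define As where "As = (\<lambda>i. fps_eval_mat (fA i) (jordan_block (n i) 0))"
  define As' where "As' = (\<lambda>i. comp_inv_eval_mat (g i) (f i) (jordan_block (n i) (\<mu> i)))"
  have "\<forall>i\<in>{1..k}. \<exists>P Q P' Q'. {P, Q, P', Q'} \<subseteq> carrier_mat (n i) (n i) \<and>
     P * P' = 1\<^sub>m (n i) \<and> Q * Q' = 1\<^sub>m (n i) \<and>
     P * (1\<^sub>m (n i) + z1 \<cdot>\<^sub>m Js i) * Q = 1\<^sub>m (n i) \<and>
     P * Js i * Q = jordan_block (n i) (\<mu> i) \<and> P * As i * Q = As' i"
    unfolding Js_def As_def As'_def \<mu>_def using z1
    by (intro ballI jordan_block_pencil_transform) (simp_all add: f_def g_def)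
  then obtain Ps Qs Ps' Qs' where blocks: "\<And>i. i \<in> {1..k} \<Longrightarrow>
     {Ps i, Qs i, Ps' i, Qs' i} \<subseteq> carrier_mat (n i) (n i) \<and>
     Ps i * Ps' i = 1\<^sub>m (n i) \<and> Qs i * Qs' i = 1\<^sub>m (n i) \<and>
     Ps i * (1\<^sub>m (n i) + z1 \<cdot>\<^sub>m Js i) * Qs i = 1\<^sub>m (n i) \<and>
     Ps i * Js i * Qs i = jordan_block (n i) (\<mu> i) \<and> Ps i * As i * Qs i = As' i"
    by metis
  define D where "D = (\<lambda>F. diag_block_mat (map F ?is) :: complex mat)"
  have N: "sum_list (map n ?is) = N"
    by (simp only: N_def interv_sum_list_conv_sum_set_nat) (auto intro: sum.cong)
  have D_carrier: "D F \<in> carrier_mat N N" if "\<And>i. i \<in> {1..k} \<Longrightarrow> F i \<in> carrier_mat (n i) (n i)" for F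
    unfolding D_def N[symmetric] using that by (intro diag_block_mat_map_carrier) auto
  have D_mult: "D F * D G = D (\<lambda>i. F i * G i)"
    if "\<And>i. i \<in> {1..k} \<Longrightarrow> F i \<in> carrier_mat (n i) (n i)"
      "\<And>i. i \<in> {1..k} \<Longrightarrow> G i \<in> carrier_mat (n i) (n i)" for F G
    unfolding D_def using that by (intro diag_block_mat_map_mult[where n = n]) auto
  have D_cong: "D F = D G" if "\<And>i. i \<in> {1..k} \<Longrightarrow> F i = G i" for F G
    unfolding D_def using that by (intro arg_cong[of _ _ diag_block_mat] map_cong) auto
  have D_one: "D (\<lambda>i. 1\<^sub>m (n i)) = 1\<^sub>m N"
    unfolding D_def N[symmetric] by (rule diag_block_mat_map_one)
  have C: "Ps i \<in> carrier_mat (n i) (n i)" "Qs i \<in> carrier_mat (n i) (n i)"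
    "Ps' i \<in> carrier_mat (n i) (n i)" "Qs' i \<in> carrier_mat (n i) (n i)" if "i \<in> {1..k}" for i
    using blocks[OF that] by auto
  have CJ: "Js i \<in> carrier_mat (n i) (n i)" and CA: "As i \<in> carrier_mat (n i) (n i)" for i
    by (auto simp: Js_def As_def fps_eval_mat_def)
  have CA': "As' i \<in> carrier_mat (n i) (n i)" for i
    by (auto simp: As'_def comp_inv_eval_mat_def fps_eval_mat_def)
  define P where "P = D Ps"
  define Q where "Q = D Qs"
  have P: "P \<in> carrier_mat N N" and Q: "Q \<in> carrier_mat N N"
    unfolding P_def Q_def using C by (auto intro: D_carrier)
  have "P * D Ps' = 1\<^sub>m N"
    unfolding P_def D_one[symmetric] using C blocks by (subst D_mult) (auto intro: D_cong)
  then have P_inv: "invertible_mat P"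
    using P C by (intro invertible_mat_if_right_inverse[of P N "D Ps'"] D_carrier) auto
  have "Q * D Qs' = 1\<^sub>m N"
    unfolding Q_def D_one[symmetric] using C blocks by (subst D_mult) (auto intro: D_cong)
  then have Q_inv: "invertible_mat Q"
    using Q C by (intro invertible_mat_if_right_inverse[of Q N "D Qs'"] D_carrier) auto
  \<comment> \<open>All three required identities reduce through this to identities on single
    blocks.\<close>
  have transform: "P * D F * Q = D G"
    if "\<And>i. i \<in> {1..k} \<Longrightarrow> F i \<in> carrier_mat (n i) (n i)"
      "\<And>i. i \<in> {1..k} \<Longrightarrow> Ps i * F i * Qs i = G i" for F G
  proof -
    have "P * D F = D (\<lambda>i. Ps i * F i)"
      unfolding P_def using C that by (intro D_mult) auto
    also have "\<dots> * Q = D (\<lambda>i. Ps i * F i * Qs i)"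
      unfolding Q_def using C that by (intro D_mult mult_carrier_mat) auto
    also have "\<dots> = D G" using that by (intro D_cong) auto
    finally show ?thesis .
  qed
  have J: "J = D Js" and A: "A = D As"
    and J': "J' = D (\<lambda>i. jordan_block (n i) (\<mu> i))" and A': "A' = D As'"
    by (simp_all add: J_def A_def J'_def A'_def D_def Js_def As_def As'_def \<mu>_def)
  have "E + z1 \<cdot>\<^sub>m J = D (\<lambda>i. 1\<^sub>m (n i)) + D (\<lambda>i. z1 \<cdot>\<^sub>m Js i)"
    by (simp add: J E_def D_one, simp add: D_def diag_block_mat_map_smult)
  also have "\<dots> = D (\<lambda>i. 1\<^sub>m (n i) + z1 \<cdot>\<^sub>m Js i)"
    unfolding D_def using CJ by (intro diag_block_mat_map_add[where n = n]) auto
  finally have EJ: "E + z1 \<cdot>\<^sub>m J = D (\<lambda>i. 1\<^sub>m (n i) + z1 \<cdot>\<^sub>m Js i)" .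
  \<comment> \<open>\<open>EJ\<close> is unfolded first, since \<open>E_def\<close> would rewrite
    the \<open>E\<close> in its left side.\<close>
  have PEQ: "P * (E + z1 \<cdot>\<^sub>m J) * Q = E"
    unfolding EJ unfolding E_def D_one[symmetric] using CJ blocks by (intro transform) auto
  have PJQ: "P * J * Q = J'"
    unfolding J J' using CJ blocks by (intro transform) auto
  have PAQ: "P * A * Q = A'"
    unfolding A A' using CA blocks by (intro transform) auto
  have CE: "E \<in> carrier_mat N N" and CJN: "J \<in> carrier_mat N N" and CAN: "A \<in> carrier_mat N N"
    and CJ'N: "J' \<in> carrier_mat N N" and CA'N: "A' \<in> carrier_mat N N"
    using CJ CA CA' by (auto simp: E_def J A J' A' intro!: D_carrier)
  \<comment> \<open>Row 0 forms \<open>E + z1 J\<close> and the other rows keep \<open>J\<close> and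
    \<open>A\<close>. As a function of z, \<open>T\<close> has its inverse at hand, namely the value
    at -z.\<close>
  define T where "T = (\<lambda>z::complex. mat 3 3 (\<lambda>(i, j). if i = j then 1 else if i = 0 \<and> j = 1 then z else 0))"
  have T: "T z \<in> carrier_mat 3 3" for z
    by (simp add: T_def)
  have "T z1 * T (- z1) = 1\<^sub>m 3"
    by (rule eq_matI)
      (auto simp: T_def scalar_prod_def numeral_3_eq_3 less_Suc_eq)
  then have T_inv: "invertible_mat (T z1)"
    using T by (intro invertible_mat_if_right_inverse[of _ 3 "T (- z1)"])
  have T_index: "T z1 $$ (0, 0) = 1" "T z1 $$ (0, 1) = z1" "T z1 $$ (0, 2) = 0"
    "T z1 $$ (1, 0) = 0" "T z1 $$ (1, 1) = 1" "T z1 $$ (1, 2) = 0"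
    "T z1 $$ (2, 0) = 0" "T z1 $$ (2, 1) = 0" "T z1 $$ (2, 2) = 1"
    by (simp_all add: T_def)
  have PEQ_C: "P * E * Q \<in> carrier_mat N N"
    using P Q CE by auto
  \<comment> \<open>Distributivity turns the pencil identity \<open>PEQ\<close> into row 0 of the
    SLOCC condition, a combination of the separately transformed matrices.\<close>
  have "P * (E + z1 \<cdot>\<^sub>m J) = P * E + z1 \<cdot>\<^sub>m (P * J)"
    using P CE CJN by (simp add: mult_add_distrib_mat[of _ N N _ N] mult_smult_distrib[of _ N N _ N])
  also have "\<dots> * Q = P * E * Q + z1 \<cdot>\<^sub>m (P * J * Q)"
    using P Q CE CJN
    by (subst add_mult_distrib_mat[of _ N N]) (auto simp: mult_smult_assoc_mat[of _ N N])
  finally have row0: "P * E * Q + z1 \<cdot>\<^sub>m J' = E"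
    using PEQ PJQ by simp
  have zero: "0 \<cdot>\<^sub>m X = 0\<^sub>m N N" and one: "1 \<cdot>\<^sub>m X = X" if "X \<in> carrier_mat N N" for X :: "complex mat"
    using that by (auto intro: eq_matI)
  have rows: "\<forall>(i, H) \<in> {(0, E), (1, J'), (2, A')}.
      T z1 $$ (i, 0) \<cdot>\<^sub>m (P * E * Q) + T z1 $$ (i, 1) \<cdot>\<^sub>m (P * J * Q)
        + T z1 $$ (i, 2) \<cdot>\<^sub>m (P * A * Q) = H"
    \<comment> \<open>The simplifier rewrites the index 1 to \<open>Suc 0\<close>, hence the second
      form of \<open>T_index\<close>.\<close>
    using PEQ_C CE CJ'N CA'N by (simp add: T_index T_index[unfolded One_nat_def] PJQ PAQ zero one row0)
  have "slocc_equivalent N (E, J, A) (E, J', A')"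
    unfolding slocc_equivalent.simps
    using CE CJN CAN CJ'N CA'N T T_inv P P_inv Q Q_inv rows by blast
  then show ?thesis
    using P P_inv Q Q_inv PEQ PJQ PAQ by blast
qed

end
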